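(* Let $n$ be an even positive integer and let $m=\lceil\log_2 n\rceil-1$, so that $2^m<n\leq 2^{m+1}$. (1) $\|n\|_2=m+1$ if and only if $n=2^{m+1}$ or $n=2^m+2^{m'}$ for some integer $m'$ with $1\leq m'<m$. (2) $\|n\|_2=m+2$ if and only if $n$ is of one of the following forms: (a) $2^{m_1}+2^{m_2}+2^{m_3}$ with integers $m=m_1>m_2>m_3\geq 1$; (b) $2^{m_1}+2^{m_2}+2^{m_3}+2^{m_4}$ with integers $m=m_1>m_2>m_3>m_4\geq 2$ and $m_1+m_4=m_2+m_3$; (c) $2^{m_1}+2^{m_1-3}+2^{m_2}+2^{m_2-1}$ with integers $m=m_1\geq m_2+3\geq 6$; (d) $2^m+2^{m-5}+2^{m-6}+2^{m-7}$ with $m\geq 10$.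
   Context: For a positive integer $l$ and $n\in l\mathbb{Z}^+$, the $l$-complexity $\|n\|_l$ is the minimal number of copies of $l$ needed to express $n$ from $l$ using only addition and multiplication (and parentheses). Equivalently, $\|l\|_l=1$ and $\|n\|_l=\min(\|a\|_l+\|b\|_l)$, the minimum over $a,b\in l\mathbb{Z}^+$ with $a+b=n$ or $ab=n$. Here $l=2$. *)

theory Defs
  imports Complex_Main
begin

datatype l_expr = Const | Add l_expr l_expr | Mult l_expr l_expr

fun l_value :: "nat \<Rightarrow> l_expr \<Rightarrow> nat" where
  "l_value l Const = l"
| "l_value l (Add e f) = l_value l e + l_value l f"
| "l_value l (Mult e f) = l_value l e * l_value l f"

fun copies :: "l_expr \<Rightarrow> nat" where
  "copies Const = 1"
| "copies (Add e f) = copies e + copies f"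
| "copies (Mult e f) = copies e + copies f"

text \<open>Only meaningful for positive \<open>l\<close> and positive multiples \<open>n\<close> of \<open>l\<close>, which are exactly the
  values of expressions (\<open>l_value_dvd\<close>, \<open>ex_l_expr\<close> below).\<close>

definition l_complexity :: "nat \<Rightarrow> nat \<Rightarrow> nat" where
  "l_complexity l n = (LEAST k. \<exists>e. l_value l e = n \<and> copies e = k)"

lemma l_value_dvd: "l dvd l_value l e"
  by (induction e) auto

lemma l_value_pos: "l > 0 \<Longrightarrow> l_value l e > 0"
  by (induction e) auto

lemma copies_pos: "copies e > 0"
  by (induction e) auto

lemma ex_l_expr:
  assumes "l dvd n" "n > 0"
  shows "\<exists>e. l_value l e = n"
proof -
  have "\<exists>e. l_value l e = l * Suc k" for k
  proof (induction k)
    case 0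
    have "l_value l Const = l * Suc 0" by simp
    then show ?case by blast
  next
    case (Suc k)
    then obtain e where "l_value l e = l * Suc k" by blast
    then have "l_value l (Add Const e) = l * Suc (Suc k)" by simp
    then show ?case by blast
  qed
  moreover obtain j where "n = l * j" using assms(1) by (elim dvdE)
  moreover have "j = Suc (j - 1)" using assms(2) \<open>n = l * j\<close> by (cases j) auto
  ultimately show ?thesis by metis
qed

lemma l_complexity_le: "l_complexity l (l_value l e) \<le> copies e"
  unfolding l_complexity_def by (rule Least_le) blast

lemma l_complexity_witness:
  assumes "l dvd n" "n > 0"
  obtains e where "l_value l e = n" "copies e = l_complexity l n"
proof -
  obtain e where "l_value l e = n" using ex_l_expr[OF assms] by blast
  then have "\<exists>k e. l_value l e = n \<and> copies e = k" by blast
  from LeastI_ex[OF this] show ?thesis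
    using that unfolding l_complexity_def by blast
qed

lemma l_complexity_self:
  assumes "l > 0"
  shows "l_complexity l l = 1"
proof -
  have "l_complexity l l \<le> 1" using l_complexity_le[of l Const] by simp
  moreover obtain e where "copies e = l_complexity l l"
    using l_complexity_witness[OF dvd_refl assms] .
  with copies_pos[of e] have "l_complexity l l > 0" by simp
  ultimately show ?thesis by simp
qed

lemma l_complexity_rec:
  assumes "l > 0" "l dvd n" "n > 0" "n \<noteq> l"
  shows "l_complexity l n =
    (LEAST k. \<exists>a b. a > 0 \<and> b > 0 \<and> l dvd a \<and> l dvd b \<and> (a + b = n \<or> a * b = n) \<and>
       k = l_complexity l a + l_complexity l b)"
    (is "_ = (LEAST k. ?P k)")
proof -
  define Q where "Q = (\<lambda>k. ?P k)"
  have up: "l_complexity l n \<le> k" if "Q k" for k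
  proof -
    from that[unfolded Q_def] obtain a b where ab: "a > 0" "b > 0" "l dvd a" "l dvd b" "a + b = n \<or> a * b = n"
      and k: "k = l_complexity l a + l_complexity l b" by blast
    obtain e where e: "l_value l e = a" "copies e = l_complexity l a"
      using l_complexity_witness[OF ab(3,1)] .
    obtain f where f: "l_value l f = b" "copies f = l_complexity l b"
      using l_complexity_witness[OF ab(4,2)] .
    show ?thesis
      using ab(5) k e f l_complexity_le[of l "Add e f"] l_complexity_le[of l "Mult e f"] by auto
  qed
  obtain e where e: "l_value l e = n" "copies e = l_complexity l n"
    using l_complexity_witness[OF assms(2,3)] .
  obtain f g where fg: "e = Add f g \<or> e = Mult f g"
    using e(1) assms(4) by (cases e) auto
  have P: "Q (l_complexity l (l_value l f) + l_complexity l (l_value l g))"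
    unfolding Q_def by (intro exI[of _ "l_value l f"] exI[of _ "l_value l g"])
      (use fg e(1) l_value_pos[OF assms(1)] l_value_dvd in auto)
  have "(LEAST k. Q k) \<le> l_complexity l (l_value l f) + l_complexity l (l_value l g)"
    using P by (rule Least_le)
  also have "\<dots> \<le> copies f + copies g"
    by (intro add_mono l_complexity_le)
  also have "\<dots> = l_complexity l n" using fg e(2) by auto
  finally have "(LEAST k. Q k) \<le> l_complexity l n" .
  moreover have "l_complexity l n \<le> (LEAST k. Q k)"
    by (rule up[OF LeastI[of Q, OF P]])
  ultimately have "l_complexity l n = (LEAST k. Q k)" by simp
  then show ?thesis unfolding Q_def .
qed

end

theory Submission
  imports Defs
begin

text \<open>
  A value built from \<open>k\<close> copies of 2 is at most \<open>2 ^ k\<close>. By induction on the expression, all values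
  \<open>v\<close> with \<open>2 ^ k < 4 * v\<close> can be listed. In a sum, unless one summand uses at most two copies, the
  value is too small. In a product, one factor must exceed half of its bound, so it is \<open>2 ^ i\<close> or
  \<open>2 ^ i * (2 ^ s + 1)\<close>, and the other exceeds a quarter of its bound. Scaling by powers of two
  preserves the list, and for the factors \<open>2 ^ s + 1\<close> the size condition leaves a few infinite
  families and finitely many odd parts, among them the sporadic \<open>135 = 3 * 5 * 9\<close>.
\<close>

text \<open>The summands are grouped by their lowest power of two, since products then only multiply the
  odd parts. The index \<open>k\<close> is the number of copies of 2, that is \<open>m + 1\<close> here and \<open>m + 2\<close> in
  \<open>suboptimal\<close>.\<close>

inductive optimal :: "nat \<Rightarrow> nat \<Rightarrow> bool" where
  power: "1 \<le> k \<Longrightarrow> v = 2 ^ k \<Longrightarrow> optimal k v"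
| two_bits: "1 \<le> i \<Longrightarrow> 1 \<le> s \<Longrightarrow> v = 2 ^ i * (2 ^ s + 1) \<Longrightarrow> k = i + s + 1 \<Longrightarrow> optimal k v"

inductive suboptimal :: "nat \<Rightarrow> nat \<Rightarrow> bool" where
  three_bits: "1 \<le> i \<Longrightarrow> 1 \<le> q \<Longrightarrow> q < p \<Longrightarrow> v = 2 ^ i * (2 ^ p + 2 ^ q + 1) \<Longrightarrow> k = i + p + 2
    \<Longrightarrow> suboptimal k v"
| product: "2 \<le> i \<Longrightarrow> 1 \<le> q \<Longrightarrow> q < p \<Longrightarrow> v = 2 ^ i * ((2 ^ p + 1) * (2 ^ q + 1))
    \<Longrightarrow> k = i + p + q + 2 \<Longrightarrow> suboptimal k v"
| three_times: "2 \<le> i \<Longrightarrow> 1 \<le> r \<Longrightarrow> v = 2 ^ i * (3 * (3 * 2 ^ r + 1)) \<Longrightarrow> k = i + r + 5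
    \<Longrightarrow> suboptimal k v"
| sporadic: "3 \<le> i \<Longrightarrow> v = 2 ^ i * 135 \<Longrightarrow> k = i + 9 \<Longrightarrow> suboptimal k v"

text \<open>The working list for values built from \<open>k\<close> copies that exceed a quarter of
  \<open>2 ^ k\<close>. Those above half of \<open>2 ^ k\<close> are \<open>optimal k\<close>; the
  others have either the shape that \<open>k - 1\<close> copies already give, or one of the
  \<open>suboptimal\<close> shapes.\<close>

definition nearly_optimal :: "nat \<Rightarrow> nat \<Rightarrow> bool" where
  "nearly_optimal k v \<longleftrightarrow> optimal k v \<or> optimal (k - 1) v \<or> suboptimal k v"

section \<open>Size bounds separating the classes\<close>

lemma two_le_power_two: "1 \<le> s \<Longrightarrow> 2 \<le> (2::nat) ^ s"
  using power_increasing[of 1 s "2::nat"] by simp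

lemma power_two_double_le: "q < p \<Longrightarrow> 2 * 2 ^ q \<le> (2::nat) ^ p"
  using power_increasing[of "Suc q" p "2::nat"] by simp

lemma optimal_le: "optimal k v \<Longrightarrow> v \<le> 2 ^ k"
  by (induction rule: optimal.induct) (auto simp: power_add algebra_simps)

lemma optimal_less: "optimal k v \<Longrightarrow> 2 ^ k < 2 * v"
  by (induction rule: optimal.induct) (auto simp: power_add algebra_simps)

lemma optimal_pos: "optimal k v \<Longrightarrow> 1 \<le> k"
  by (induction rule: optimal.induct) auto

text \<open>Each shape consists of odd factors whose total falls short of half of the power of two
  allotted to them. This keeps \<open>suboptimal\<close> apart from \<open>optimal\<close> at the
  same index.\<close>

lemma suboptimal_less:
  assumes "suboptimal k v"
  shows "2 * v < 2 ^ k"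
  using assms
proof cases
  case (three_bits i q p)
  have "2 * 2 ^ q \<le> (2::nat) ^ p" "2 \<le> (2::nat) ^ q"
    using three_bits power_two_double_le two_le_power_two by auto
  then have "2 * ((2::nat) ^ p + 2 ^ q + 1) < 2 ^ p * 4" by simp
  then have "2 ^ i * (2 * ((2::nat) ^ p + 2 ^ q + 1)) < 2 ^ i * (2 ^ p * 4)"
    by (simp only: mult_less_cancel1) simp
  then show ?thesis using three_bits by (simp add: power_add algebra_simps)
next
  case (product i q p)
  define x y where "x = (2::nat) ^ p" and "y = (2::nat) ^ q"
  have xy: "2 * y \<le> x" "2 \<le> y"
    using product power_two_double_le two_le_power_two by (auto simp: x_def y_def)
  then have "4 \<le> x" by simp
  \<comment> \<open>After subtracting the lower bounds 4 and 2, both sides are polynomials in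
    \<open>u\<close> and \<open>w\<close> and the inequality holds coefficient by coefficient. The
    same device recurs in later size estimates.\<close>
  then obtain u w where "x = 4 + u" "y = 2 + w" using xy(2) by (meson le_Suc_ex)
  then have "2 * ((x + 1) * (y + 1)) < x * y * 4"
    using xy by (simp add: algebra_simps)
  then have "2 ^ i * (2 * ((x + 1) * (y + 1))) < 2 ^ i * (x * y * 4)"
    by (simp only: mult_less_cancel1) simp
  then show ?thesis using product by (simp add: power_add algebra_simps x_def y_def)
next
  case (three_times i r)
  have "2 \<le> (2::nat) ^ r" using three_times two_le_power_two by auto
  then show ?thesis using three_times by (simp add: power_add algebra_simps)
next
  case (sporadic i)
  then show ?thesis by (simp add: power_add)
qed

text \<open>The other two alternatives are bounded by \<open>2 ^ (k - 1)\<close>, so above half of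
  \<open>2 ^ k\<close> only the first survives.\<close>

lemma nearly_optimal_imp_optimal:
  assumes "nearly_optimal k v" "2 ^ k < 2 * v"
  shows "optimal k v"
proof -
  have "\<not> optimal (k - 1) v"
  proof
    assume "optimal (k - 1) v"
    from optimal_le[OF this] optimal_pos[OF this] assms(2) show False by (cases k) auto
  qed
  then show ?thesis
    using assms suboptimal_less[of k v] by (auto simp: nearly_optimal_def)
qed

section \<open>Shifts by powers of two and sums\<close>

lemma optimal_power_add:
  assumes "1 \<le> j" "j \<le> k"
  shows "optimal (Suc k) (2 ^ k + 2 ^ j)"
proof (cases "j = k")
  case True
  then show ?thesis by (intro optimal.power) auto
next
  case False
  then obtain s where "k = j + s" "1 \<le> s"
    using assms by (metis less_iff_Suc_add le_neq_implies_less add_Suc_right le_add1 plus_1_eq_Suc)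
  then show ?thesis
    using assms by (intro optimal.two_bits[of j s]) (auto simp: power_add algebra_simps)
qed

lemma optimal_shift: "optimal k v \<Longrightarrow> optimal (c + k) (2 ^ c * v)"
proof (induction rule: optimal.induct)
  case (power k v)
  then show ?case by (intro optimal.power) (auto simp: power_add algebra_simps)
next
  case (two_bits i s v k)
  then show ?case by (intro optimal.two_bits[of "c + i" s]) (auto simp: power_add algebra_simps)
qed

lemma suboptimal_shift: "suboptimal k v \<Longrightarrow> suboptimal (c + k) (2 ^ c * v)"
proof (induction rule: suboptimal.induct)
  case (three_bits i q p v k)
  then show ?case by (intro suboptimal.three_bits[of "c + i" q p]) (auto simp: power_add algebra_simps)
next
  case (product i q p v k)
  then show ?case by (intro suboptimal.product[of "c + i" q p]) (auto simp: power_add algebra_simps)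
next
  case (three_times i r v k)
  then show ?case by (intro suboptimal.three_times[of "c + i" r]) (auto simp: power_add algebra_simps)
next
  case (sporadic i v k)
  then show ?case by (intro suboptimal.sporadic[of "c + i"]) (auto simp: power_add algebra_simps)
qed

lemma nearly_optimal_shift:
  assumes "nearly_optimal k v" "1 \<le> k"
  shows "nearly_optimal (c + k) (2 ^ c * v)"
proof -
  have "c + k - 1 = c + (k - 1)" using assms(2) by simp
  then show ?thesis
    using assms optimal_shift suboptimal_shift unfolding nearly_optimal_def by metis
qed

text \<open>Adding 2 to a value with lowest bit 2 carries once and gives a power or two bits again,
  at index \<open>k\<close>. If the lowest of two bits is higher, 2 becomes a third bit.\<close>

lemma optimal_add_two:
  assumes "optimal k v"
  shows "nearly_optimal (Suc k) (v + 2)"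
  using assms
proof cases
  case power
  then show ?thesis using optimal_power_add[of 1 k] by (simp add: nearly_optimal_def)
next
  case (two_bits i s)
  show ?thesis
  proof (cases "i = 1")
    case True
    have "optimal (Suc (s + 1)) (2 ^ (s + 1) + 2 ^ 2)"
      using two_bits by (intro optimal_power_add) auto
    then show ?thesis using two_bits True by (simp add: nearly_optimal_def numeral_eq_Suc)
  next
    case False
    then obtain j where "i = Suc j" "1 \<le> j" using two_bits by (cases i) auto
    then have "suboptimal (Suc k) (v + 2)"
      using two_bits by (intro suboptimal.three_bits[of 1 j "j + s"]) (auto simp: power_add algebra_simps)
    then show ?thesis by (simp add: nearly_optimal_def)
  qed
qed

text \<open>If both summands use at least three copies, then \<open>4 * (2 ^ a + 2 ^ b)\<close> is
  at most \<open>2 ^ (a + b)\<close>, so \<open>b\<close> is 1 or 2. The hypothesis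
  \<open>near\<close> is the shape of the induction hypothesis for the larger summand.\<close>

lemma nearly_optimal_add:
  assumes near: "2 ^ a < 4 * v \<Longrightarrow> nearly_optimal a v"
    and v: "even v" "v \<le> 2 ^ a" and w: "even w" "0 < w" "w \<le> 2 ^ b"
    and ab: "1 \<le> b" "b \<le> a" and large: "2 ^ (a + b) < 4 * (v + w)"
  shows "nearly_optimal (a + b) (v + w)"
proof -
  consider "b = 1" | "b = 2" | "3 \<le> b" using ab by linarith
  then show ?thesis
  proof cases
    case 1
    then have w2: "w = 2" using w by (auto elim: evenE)
    obtain c where c: "a = Suc c" using ab by (cases a) auto
    show ?thesis
    proof (cases "2 ^ c < v")
      case True
      then have "optimal a v" using near nearly_optimal_imp_optimal c by auto
      then show ?thesis using optimal_add_two 1 w2 by simp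
    next
      case False
      \<comment> \<open>Now \<open>v\<close> is even, at most \<open>2 ^ c\<close> and above
        \<open>2 ^ c - 2\<close>. This forces \<open>v = 2 ^ c\<close>, except for
        \<open>c = 0\<close>, where \<open>v = 0\<close> and the sum is 2.\<close>
      have *: "2 ^ c < v + 2" using large c 1 w2 by simp
      show ?thesis
      proof (cases "c = 0")
        case True
        then have "v = 0" using False v by (cases v) auto
        then have "optimal 1 (v + w)" using w2 by (intro optimal.power) auto
        then show ?thesis using True c 1 by (simp add: nearly_optimal_def)
      next
        case c0: False
        then obtain x :: nat where x: "2 ^ c = 2 * x" by (cases c) auto
        obtain y where "v = 2 * y" using v by (auto elim!: evenE)
        then have "v = 2 ^ c" using False * x by simp
        then show ?thesis
          using optimal_power_add[of 1 c] c0 c 1 w2 by (simp add: nearly_optimal_def)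
      qed
    qed
  next
    case 2
    \<comment> \<open>The sum exceeds \<open>2 ^ a\<close> by at most 4. Halving everything turns
      evenness into integrality, leaving an excess of 2 or 4.\<close>
    obtain x :: nat where x: "2 ^ a = 2 * x" using ab by (cases a) auto
    obtain y z where yz: "v = 2 * y" "w = 2 * z" using v w by (auto elim!: evenE)
    have "0 < z" "z \<le> 2" "y \<le> x" "x < y + z" using w v large x yz 2 by auto
    then have "y + z = x + 1 \<or> y + z = x + 2" by linarith
    then have "v + w = 2 ^ a + 2 ^ 1 \<or> v + w = 2 ^ a + 2 ^ 2" using x yz by auto
    then show ?thesis
      using optimal_power_add[of 1 a] optimal_power_add[of 2 a] ab 2
      by (auto simp: nearly_optimal_def)
  next
    case 3
    then have "2 ^ 3 \<le> (2::nat) ^ a" "2 ^ 3 \<le> (2::nat) ^ b"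
      by (intro power_increasing; use ab in simp)+
    then obtain x y :: nat where xy: "2 ^ a = 2 ^ 3 + x" "2 ^ b = 2 ^ 3 + y"
      by (meson le_Suc_ex)
    have "v + w \<le> 2 ^ a + 2 ^ b" using v(2) w(3) by (rule add_mono)
    then have False using large xy by (simp add: power_add algebra_simps)
    then show ?thesis ..
  qed
qed

section \<open>Products with a factor \<open>2 ^ s + 1\<close>\<close>

text \<open>Distinct exponents give the \<open>product\<close> shape. A square is
  \<open>2 ^ (2 * s) + 2 ^ (s + 1) + 1\<close>, which has three bits unless \<open>s = 1\<close>,
  when it is \<open>9 = 2 ^ 3 + 1\<close>.\<close>

lemma two_bits_product:
  assumes "1 \<le> s" "1 \<le> t" "2 \<le> i"
  shows "nearly_optimal (i + s + t + 2) (2 ^ i * ((2 ^ s + 1) * (2 ^ t + 1)))"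
proof -
  have diagonal: ?thesis if "s = t"
  proof (cases "s = 1")
    case True
    then have "optimal (i + s + t + 2) (2 ^ i * ((2 ^ s + 1) * (2 ^ t + 1)))"
      using that assms by (intro optimal.two_bits[of i 3]) auto
    then show ?thesis by (simp add: nearly_optimal_def)
  next
    case False
    then have "suboptimal (i + s + t + 2) (2 ^ i * ((2 ^ s + 1) * (2 ^ t + 1)))"
      using that assms by (intro suboptimal.three_bits[of i "s + 1" "s + s"])
        (auto simp: power_add algebra_simps)
    then show ?thesis by (simp add: nearly_optimal_def)
  qed
  consider "s = t" | "s < t" | "t < s" by linarith
  then show ?thesis
  proof cases
    case 1
    then show ?thesis by (rule diagonal)
  next
    case 2
    then have "suboptimal (i + s + t + 2) (2 ^ i * ((2 ^ s + 1) * (2 ^ t + 1)))"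
      using assms by (intro suboptimal.product[of i s t]) auto
    then show ?thesis by (simp add: nearly_optimal_def)
  next
    case 3
    then have "suboptimal (i + s + t + 2) (2 ^ i * ((2 ^ s + 1) * (2 ^ t + 1)))"
      using assms by (intro suboptimal.product[of i t s]) auto
    then show ?thesis by (simp add: nearly_optimal_def)
  qed
qed


text \<open>Small exponents are tested individually. From 16 on, \<open>2 ^ s + 1\<close> is so
  close to \<open>2 ^ s\<close> that the size conditions fail by crude estimates.\<close>

lemma power_two_cases:
  assumes "1 \<le> s"
  obtains "s = 1" | "s = 2" | "s = 3" | x where "(2::nat) ^ s = 16 + x"
proof -
  consider "s = 1" | "s = 2" | "s = 3" | "4 \<le> s" using assms by linarith
  then show thesis
  proof cases
    case 4
    then have "2 ^ 4 \<le> (2::nat) ^ s" by (intro power_increasing) auto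
    then show thesis using that(4)[of "2 ^ s - 16"] by simp
  qed (use that in auto)
qed

text \<open>The condition \<open>large\<close> asks that the factors \<open>1 + 1 / 2 ^ s\<close>
  and \<open>1 + (2 ^ q + 1) / 2 ^ p\<close> multiply to more than 2. Since \<open>2 ^ p\<close> is
  at least twice \<open>2 ^ q\<close>, this forces \<open>s\<close> to be 1 or 2 and
  \<open>p\<close> to be close to \<open>q\<close>.\<close>

lemma two_bits_mult_three_bits:
  assumes "1 \<le> s" "1 \<le> q" "q < p" "2 \<le> i"
    and large: "2 * 2 ^ s * 2 ^ p < (2 ^ s + 1) * (2 ^ p + 2 ^ q + (1::nat))"
  shows "nearly_optimal (i + s + p + 3) (2 ^ i * ((2 ^ s + 1) * (2 ^ p + 2 ^ q + 1)))"
proof -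
  define y z where "y = (2::nat) ^ p" and "z = (2::nat) ^ q"
  have z: "2 \<le> z" using assms by (simp add: z_def two_le_power_two)
  consider "p = q + 1" | "p = q + 2" | "q + 3 \<le> p" using assms by linarith
  then have y: "p = q + 1 \<and> y = 2 * z \<or> p = q + 2 \<and> y = 4 * z \<or> 8 * z \<le> y"
  proof cases
    case 3
    then have "2 ^ (q + 3) \<le> (2::nat) ^ p" by (intro power_increasing) auto
    then show ?thesis by (simp add: y_def z_def power_add)
  qed (auto simp: y_def z_def power_add)
  have q: "q = 1 \<or> q = 2 \<or> 8 \<le> z"
  proof -
    have "8 \<le> z" if "3 \<le> q" using power_increasing[of 3 q "2::nat"] that by (simp add: z_def)
    then show ?thesis using assms by linarith
  qed
  have large': "2 * 2 ^ s * y < (2 ^ s + 1) * (y + z + 1)"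
    using large by (simp add: y_def z_def)
  show ?thesis
    using \<open>1 \<le> s\<close>
  proof (cases s rule: power_two_cases)
    case 1
    then have "y < 3 * z + 3" using large' by simp
    then consider "p = q + 1" | "p = q + 2" "z < 3" using y z by fastforce
    then show ?thesis
    proof cases
      case 1
      \<comment> \<open>With \<open>p = q + 1\<close> the three-bit factor is
        \<open>3 * 2 ^ q + 1\<close>.\<close>
      then have "suboptimal (i + s + p + 3) (2 ^ i * ((2 ^ s + 1) * (2 ^ p + 2 ^ q + 1)))"
        using \<open>s = 1\<close> assms by (intro suboptimal.three_times[of i q]) auto
      then show ?thesis by (simp add: nearly_optimal_def)
    next
      case 2
      then have "q = 1" using q by (auto simp: z_def)
      \<comment> \<open>Here \<open>3 * 11 = 33 = 2 ^ 5 + 1\<close>, one index lower than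
        expected.\<close>
      have "optimal (i + s + p + 3 - 1) (2 ^ i * ((2 ^ s + 1) * (2 ^ p + 2 ^ q + 1)))"
        using assms 2 \<open>q = 1\<close> \<open>s = 1\<close> by (intro optimal.two_bits[of i 5]) auto
      then show ?thesis by (simp add: nearly_optimal_def)
    qed
  next
    case 2
    then have "3 * y < 5 * z + 5" using large' by simp
    then have "p = q + 1" "z < 5" using y z by fastforce+
    then consider "q = 1" | "q = 2" using q by auto
    then show ?thesis
    proof cases
      case 1
      \<comment> \<open>Here \<open>5 * 7 = 35 = 2 ^ 5 + 2 + 1\<close>.\<close>
      have "suboptimal (i + s + p + 3) (2 ^ i * ((2 ^ s + 1) * (2 ^ p + 2 ^ q + 1)))"
        using assms 1 \<open>p = q + 1\<close> \<open>s = 2\<close> by (intro suboptimal.three_bits[of i 1 5]) auto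
      then show ?thesis by (simp add: nearly_optimal_def)
    next
      case 2
      \<comment> \<open>Here \<open>5 * 13 = 65 = 2 ^ 6 + 1\<close>, again one index lower.\<close>
      have "optimal (i + s + p + 3 - 1) (2 ^ i * ((2 ^ s + 1) * (2 ^ p + 2 ^ q + 1)))"
        using assms 2 \<open>p = q + 1\<close> \<open>s = 2\<close> by (intro optimal.two_bits[of i 6]) auto
      then show ?thesis by (simp add: nearly_optimal_def)
    qed
  next
    case 3
    then have "7 * y < 9 * z + 9" using large' by simp
    then have False using y z by fastforce
    then show ?thesis ..
  next
    case (4 x)
    obtain w where w: "y = 2 * z + w" using y z
      by (metis add.right_neutral assms(3) le_add_diff_inverse power_two_double_le y_def z_def)
    obtain u where u: "z = 2 + u" using z le_Suc_ex by blast
    have False using large' unfolding 4 w u by (simp add: algebra_simps)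
    then show ?thesis ..
  qed
qed

text \<open>Three factors \<open>1 + 1 / 2 ^ s\<close> must multiply to more than 2. Apart from the
  exponents 1, 1 and an arbitrary third, only 75 and 135 remain as odd parts.\<close>

lemma two_bits_mult_product:
  assumes "1 \<le> s" "1 \<le> q" "q < p" "3 \<le> i"
    and large: "2 * 2 ^ s * 2 ^ p * 2 ^ q < (2 ^ s + 1) * ((2 ^ p + 1) * (2 ^ q + (1::nat)))"
  shows "nearly_optimal (i + s + p + q + 3) (2 ^ i * ((2 ^ s + 1) * ((2 ^ p + 1) * (2 ^ q + 1))))"
proof -
  define x y z where "x = (2::nat) ^ s" and "y = (2::nat) ^ p" and "z = (2::nat) ^ q"
  have large': "2 * x * y * z < (x + 1) * ((y + 1) * (z + 1))"
    using large by (simp add: x_def y_def z_def)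
  have sporadic: ?thesis if "s + p + q = 6" "(x + 1) * ((y + 1) * (z + 1)) = 135"
  proof -
    have "suboptimal (i + s + p + q + 3) (2 ^ i * ((x + 1) * ((y + 1) * (z + 1))))"
      using assms that by (intro suboptimal.sporadic[of i]) auto
    then show ?thesis by (simp add: nearly_optimal_def x_def y_def z_def)
  qed
  have x: "s = 1 \<and> x = 2 \<or> s = 2 \<and> x = 4 \<or> s = 3 \<and> x = 8 \<or> 16 \<le> x"
    using \<open>1 \<le> s\<close> by (cases s rule: power_two_cases) (auto simp: x_def)
  have "1 \<le> p" using assms by simp
  then have y: "p = 1 \<and> y = 2 \<or> p = 2 \<and> y = 4 \<or> p = 3 \<and> y = 8 \<or> 16 \<le> y"
    by (cases p rule: power_two_cases) (auto simp: y_def)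
  consider "q = 1" | "q = 2" | "3 \<le> q" using assms by linarith
  then show ?thesis
  proof cases
    case 1
    then have zp: "z = 2" "2 \<le> p" using assms by (auto simp: z_def)
    then have *: "x * y < 3 * x + 3 * y + 3" using large' by (simp add: algebra_simps)
    consider "s = 1" | "s = 2" "p = 2" | "s = 2" "p = 3" | "s = 3" "p = 2"
    proof -
      have "16 \<le> x \<Longrightarrow> False" if "4 \<le> y"
        using * le_Suc_ex[of 16 x] le_Suc_ex[OF that] by (auto simp: algebra_simps)
      moreover have "s = 3 \<Longrightarrow> p = 2" using * x y zp by (auto simp: x_def)
      moreover have "s = 2 \<Longrightarrow> p = 2 \<or> p = 3" using * x y zp by (auto simp: x_def)
      ultimately show ?thesis using that x y zp by fastforce
    qed
    then show ?thesis
    proof cases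
      case 1
      \<comment> \<open>The two factors 3 merge into \<open>9 = 2 ^ 3 + 1\<close>, so only two
        factors remain.\<close>
      have "nearly_optimal (i + p + 3 + 2) (2 ^ i * ((2 ^ p + 1) * (2 ^ 3 + 1)))"
        using assms zp by (intro two_bits_product) auto
      moreover have "i + p + 3 + 2 = i + s + p + q + 3" using 1 \<open>q = 1\<close> by simp
      moreover have "(2 ^ p + 1) * (2 ^ 3 + 1) = (2 ^ s + 1) * ((2 ^ p + 1) * (2 ^ q + (1::nat)))"
        using 1 \<open>q = 1\<close> by simp
      ultimately show ?thesis by metis
    next
      case 2
      \<comment> \<open>Here \<open>3 * 5 * 5 = 75 = 3 * (3 * 2 ^ 3 + 1)\<close>.\<close>
      have "suboptimal (i + s + p + q + 3) (2 ^ i * ((2 ^ s + 1) * ((2 ^ p + 1) * (2 ^ q + 1))))"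
        using assms 2 \<open>q = 1\<close> by (intro suboptimal.three_times[of i 3]) auto
      then show ?thesis by (simp add: nearly_optimal_def)
    \<comment> \<open>Both remaining cases are orderings of \<open>3 * 5 * 9 = 135\<close>.\<close>
    qed (rule sporadic; use \<open>q = 1\<close> in \<open>simp add: x_def y_def z_def\<close>)+
  next
    case 2
    then have zp: "z = 4" "3 \<le> p" using assms by (auto simp: z_def)
    then have *: "3 * (x * y) < 5 * x + 5 * y + 5" using large' by (simp add: algebra_simps)
    have y8: "8 \<le> y" using y zp by auto
    have "x < 4"
    proof (rule ccontr)
      assume "\<not> x < 4"
      then show False using * le_Suc_ex[of 4 x] le_Suc_ex[OF y8] by (auto simp: algebra_simps)
    qed
    then have "s = 1" using x by auto
    moreover have "p = 3" using * x y zp \<open>s = 1\<close> by (auto simp: x_def)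
    ultimately show ?thesis using 2 by (intro sporadic) (auto simp: x_def y_def z_def)
  next
    case 3
    \<comment> \<open>The extreme case \<open>3 * 17 * 9 = 459\<close> already misses
      \<open>2 * 2 * 16 * 8 = 512\<close>.\<close>
    have "2 ^ 3 \<le> z" "2 ^ 4 \<le> y" unfolding y_def z_def using assms 3
      by (auto intro!: power_increasing simp del: power_numeral)
    moreover have "2 \<le> x" using x by auto
    ultimately obtain u v w where "x = 2 + u" "y = 2 ^ 4 + v" "z = 2 ^ 3 + w"
      by (meson le_Suc_ex)
    then have False using large' by (simp add: algebra_simps)
    then show ?thesis ..
  qed
qed

text \<open>Reduces a size condition to one on odd parts.\<close>

lemma cancel_power_two_less:
  assumes "2 ^ k < 4 * u" "u = 2 ^ c * w" "2 ^ k = 2 ^ c * (4 * (x::nat))"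
  shows "x < w"
  using assms by simp

lemma two_bits_mult_suboptimal:
  assumes "1 \<le> i" "1 \<le> s" "suboptimal k v"
    and large: "2 ^ (i + s + 1 + k) < 4 * (2 ^ i * (2 ^ s + 1) * v)"
  shows "nearly_optimal (i + s + 1 + k) (2 ^ i * (2 ^ s + 1) * v)"
  using assms(3)
proof cases
  case (three_bits j q p)
  have eq: "2 ^ i * (2 ^ s + 1) * v = 2 ^ (i + j) * ((2 ^ s + 1) * (2 ^ p + 2 ^ q + 1))"
    by (simp only: three_bits power_add mult.assoc mult.left_commute)
  have "2 * 2 ^ s * 2 ^ p < (2 ^ s + 1) * (2 ^ p + 2 ^ q + (1::nat))"
    by (rule cancel_power_two_less[OF large eq]) (simp add: three_bits power_add)
  then have "nearly_optimal (i + j + s + p + 3) (2 ^ (i + j) * ((2 ^ s + 1) * (2 ^ p + 2 ^ q + 1)))"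
    using assms three_bits by (intro two_bits_mult_three_bits) auto
  moreover have "i + j + s + p + 3 = i + s + 1 + k" using three_bits by simp
  ultimately show ?thesis unfolding eq by metis
next
  case (product j q p)
  have eq: "2 ^ i * (2 ^ s + 1) * v = 2 ^ (i + j) * ((2 ^ s + 1) * ((2 ^ p + 1) * (2 ^ q + 1)))"
    by (simp only: product power_add mult.assoc mult.left_commute)
  have "2 * 2 ^ s * 2 ^ p * 2 ^ q < (2 ^ s + 1) * ((2 ^ p + 1) * (2 ^ q + (1::nat)))"
    by (rule cancel_power_two_less[OF large eq]) (simp add: product power_add)
  then have "nearly_optimal (i + j + s + p + q + 3)
      (2 ^ (i + j) * ((2 ^ s + 1) * ((2 ^ p + 1) * (2 ^ q + 1))))"
    using assms product by (intro two_bits_mult_product) auto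
  moreover have "i + j + s + p + q + 3 = i + s + 1 + k" using product by simp
  ultimately show ?thesis unfolding eq by metis
next
  case (three_times j r)
  have eq: "2 ^ i * (2 ^ s + 1) * v = 2 ^ (i + j) * ((2 ^ s + 1) * (3 * (3 * 2 ^ r + 1)))"
    by (simp only: three_times power_add mult.assoc mult.left_commute)
  \<comment> \<open>No product of this kind is large enough, though narrowly: for
    \<open>s = r = 1\<close> the comparison is 64 against 63.\<close>
  have "16 * 2 ^ s * 2 ^ r < (2 ^ s + 1) * (3 * (3 * 2 ^ r + (1::nat)))"
    by (rule cancel_power_two_less[OF large eq]) (simp add: three_times power_add)
  moreover obtain x y where "(2::nat) ^ s = 2 + x" "(2::nat) ^ r = 2 + y"
    using two_le_power_two assms three_times by (metis le_Suc_ex)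
  ultimately have False by (simp add: algebra_simps)
  then show ?thesis ..
next
  case (sporadic j)
  have eq: "2 ^ i * (2 ^ s + 1) * v = 2 ^ (i + j) * ((2 ^ s + 1) * 135)"
    by (simp only: sporadic power_add mult.assoc mult.left_commute)
  have "256 * 2 ^ s < (2 ^ s + 1) * (135::nat)"
    by (rule cancel_power_two_less[OF large eq]) (simp add: sporadic power_add)
  then have False using two_le_power_two[OF assms(2)] by simp
  then show ?thesis ..
qed

text \<open>A power of two as first factor only shifts. Otherwise the odd part of \<open>v\<close>
  is \<open>2 ^ s + 1\<close>, and each alternative for \<open>w\<close> leads to a product treated
  above or settled by size.\<close>

lemma nearly_optimal_mult:
  assumes "optimal a v" "nearly_optimal b w" "1 \<le> b"
    and large: "2 ^ (a + b) < 4 * (v * w)"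
  shows "nearly_optimal (a + b) (v * w)"
  using assms(1)
proof cases
  case power
  then show ?thesis using nearly_optimal_shift assms by simp
next
  case (two_bits i s)
  consider "optimal b w" | "optimal (b - 1) w" | "suboptimal b w"
    using assms(2) by (auto simp: nearly_optimal_def)
  then show ?thesis
  proof cases
    case 1
    then show ?thesis
    proof cases
      case power
      then show ?thesis
        using optimal_shift[OF assms(1), of b] by (simp add: nearly_optimal_def ac_simps)
    next
      case w: (two_bits j t)
      have "nearly_optimal (i + j + s + t + 2) (2 ^ (i + j) * ((2 ^ s + 1) * (2 ^ t + 1)))"
        using two_bits w by (intro two_bits_product) auto
      moreover have "i + j + s + t + 2 = a + b" using two_bits w by simp
      moreover have "2 ^ (i + j) * ((2 ^ s + 1) * (2 ^ t + 1)) = v * w"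
        by (simp only: two_bits w power_add mult.assoc mult.left_commute)
      ultimately show ?thesis by metis
    qed
  next
    case 2
    then show ?thesis
    proof cases
      case power
      then have "optimal (a + b - 1) (v * w)"
        using optimal_shift[OF assms(1), of "b - 1"] assms(3) by (simp add: ac_simps)
      then show ?thesis by (simp add: nearly_optimal_def)
    next
      case w: (two_bits j t)
      then have b: "b = j + t + 2" using assms(3) by simp
      have eq: "v * w = 2 ^ (i + j) * ((2 ^ s + 1) * (2 ^ t + 1))"
        by (simp only: two_bits w power_add mult.assoc mult.left_commute)
      \<comment> \<open>Because \<open>w\<close> fits index \<open>b - 1\<close>, the bound is twice
        as strict and leaves only \<open>3 * 3 = 2 ^ 3 + 1\<close>.\<close>
      have *: "2 * 2 ^ s * 2 ^ t < (2 ^ s + 1) * (2 ^ t + (1::nat))"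
        by (rule cancel_power_two_less[OF large eq]) (simp add: two_bits b power_add)
      obtain x y where xy: "(2::nat) ^ s = 2 + x" "(2::nat) ^ t = 2 + y"
        using two_le_power_two two_bits w by (metis le_Suc_ex)
      with * have "x = 0" "y = 0" by (simp_all add: algebra_simps)
      with xy have "s = 1" "t = 1" using power_inject_exp[of "2::nat" _ 1] by auto
      then have "optimal (a + b - 1) (v * w)"
        unfolding eq using two_bits b by (intro optimal.two_bits[of "i + j" 3]) auto
      then show ?thesis by (simp add: nearly_optimal_def)
    qed
  next
    case 3
    then show ?thesis
      using two_bits_mult_suboptimal two_bits large by simp
  qed
qed

section \<open>Classification of the values of expressions\<close>

text \<open>For numbers that are at least 2 the sum never exceeds the product.\<close>

lemma l_value_le: "l_value 2 e \<le> 2 ^ copies e"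
proof (induction e)
  case (Add e f)
  obtain x y where "(2::nat) ^ copies e = 2 + x" "(2::nat) ^ copies f = 2 + y"
    using two_le_power_two copies_pos by (metis One_nat_def Suc_leI le_Suc_ex)
  then show ?case using Add by (simp add: power_add algebra_simps)
qed (auto simp: power_add intro: mult_mono)

lemma l_value_nearly_optimal:
  "2 ^ copies e < 4 * l_value 2 e \<Longrightarrow> nearly_optimal (copies e) (l_value 2 e)"
proof (induction e)
  case Const
  then show ?case by (auto simp: nearly_optimal_def intro: optimal.power)
next
  case (Add e f)
  note facts = l_value_dvd[of 2] l_value_pos[of 2] l_value_le copies_pos
  show ?case
  proof (cases "copies f \<le> copies e")
    case True
    have "nearly_optimal (copies e + copies f) (l_value 2 e + l_value 2 f)"
      by (rule nearly_optimal_add) (use Add True facts in \<open>auto simp: Suc_le_eq\<close>)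
    then show ?thesis by simp
  next
    case False
    have "nearly_optimal (copies f + copies e) (l_value 2 f + l_value 2 e)"
      by (rule nearly_optimal_add) (use Add False facts in \<open>auto simp: Suc_le_eq ac_simps\<close>)
    then show ?thesis by (simp add: ac_simps)
  qed
next
  case (Mult e f)
  \<comment> \<open>The case where the first factor exceeds half of its bound. Commutativity covers
    the other case, since two factors of at most half would give at most a quarter.\<close>
  have *: "nearly_optimal (copies e + copies f) (l_value 2 e * l_value 2 f)"
    if e: "2 ^ copies e < 4 * l_value 2 e \<Longrightarrow> nearly_optimal (copies e) (l_value 2 e)"
      and f: "2 ^ copies f < 4 * l_value 2 f \<Longrightarrow> nearly_optimal (copies f) (l_value 2 f)"
      and large: "2 ^ (copies e + copies f) < 4 * (l_value 2 e * l_value 2 f)"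
      and half: "2 ^ copies e < 2 * l_value 2 e" for e f
  proof -
    have "2 ^ copies e * 2 ^ copies f < 4 * (l_value 2 e * l_value 2 f)"
      using large by (simp add: power_add)
    also have "\<dots> \<le> 4 * (2 ^ copies e * l_value 2 f)"
      using l_value_le by simp
    finally have "2 ^ copies e * 2 ^ copies f < 2 ^ copies e * (4 * l_value 2 f)" by simp
    then have "2 ^ copies f < 4 * l_value 2 f" by (simp only: mult_less_cancel1)
    moreover have "optimal (copies e) (l_value 2 e)"
      using nearly_optimal_imp_optimal e half by simp
    ultimately show ?thesis
      using nearly_optimal_mult f large copies_pos[of f] by simp
  qed
  show ?case
  proof (cases "2 ^ copies e < 2 * l_value 2 e")
    case True
    then have "nearly_optimal (copies e + copies f) (l_value 2 e * l_value 2 f)"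
      using Mult by (intro *) auto
    then show ?thesis by simp
  next
    case False
    have "2 ^ copies f < 2 * l_value 2 f"
    proof (rule ccontr)
      assume "\<not> ?thesis"
      then have "(2 * l_value 2 e) * (2 * l_value 2 f) \<le> 2 ^ copies e * 2 ^ copies f"
        using False by (intro mult_mono) auto
      then show False using Mult.prems by (simp add: power_add)
    qed
    then have "nearly_optimal (copies f + copies e) (l_value 2 f * l_value 2 e)"
      using Mult by (intro *) (auto simp: ac_simps)
    then show ?thesis by (simp add: ac_simps)
  qed
qed

section \<open>Expressions for the listed values\<close>

definition realizable :: "nat \<Rightarrow> nat \<Rightarrow> bool" where
  "realizable k v \<longleftrightarrow> (\<exists>e. l_value 2 e = v \<and> copies e = k)"

lemma realizable_add: "realizable a v \<Longrightarrow> realizable b w \<Longrightarrow> realizable (a + b) (v + w)"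
  unfolding realizable_def by (metis l_value.simps(2) copies.simps(2))

lemma realizable_mult: "realizable a v \<Longrightarrow> realizable b w \<Longrightarrow> realizable (a + b) (v * w)"
  unfolding realizable_def by (metis l_value.simps(3) copies.simps(3))

lemma realizable_two: "realizable 1 2"
  unfolding realizable_def by (metis l_value.simps(1) copies.simps(1))

lemma realizable_shift: "realizable k v \<Longrightarrow> realizable (c + k) (2 ^ c * v)"
proof (induction c)
  case (Suc c)
  then show ?case using realizable_mult[OF realizable_two, of "c + k" "2 ^ c * v"] by (simp add: mult.assoc)
qed simp

lemma realizable_power: "1 \<le> k \<Longrightarrow> realizable k (2 ^ k)"
  using realizable_shift[OF realizable_two, of "k - 1"] by (cases k) (auto simp: ac_simps)

lemma optimal_imp_realizable:
  assumes "optimal k v"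
  shows "realizable k v"
  using assms
proof cases
  case power
  then show ?thesis by (simp add: realizable_power)
next
  case (two_bits i s)
  have "realizable (i - 1 + (s + 1 + 1)) (2 ^ (i - 1) * (2 ^ (s + 1) + 2))"
    by (intro realizable_shift realizable_add realizable_power realizable_two) simp
  then show ?thesis using two_bits by (cases i) (auto simp: algebra_simps)
qed

text \<open>Every odd factor takes one factor 2 to become an even value. The lower bounds on
  \<open>i\<close> in the definition supply exactly these; the rest of \<open>2 ^ i\<close> is a
  shift.\<close>

lemma suboptimal_imp_realizable:
  assumes "suboptimal k v"
  shows "realizable k v"
proof -
  have two: "realizable (s + 2) (2 * (2 ^ s + 1))" if "1 \<le> s" for s
    using that by (intro optimal_imp_realizable optimal.two_bits[of 1 s]) auto
  have three: "realizable (p + 3) (2 * (2 ^ p + 2 ^ q + 1))" if "1 \<le> q" "q < p" for p q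
  proof -
    have "optimal (Suc (p + 1)) (2 ^ (p + 1) + 2 ^ (q + 1))"
      using that by (intro optimal_power_add) auto
    then have "realizable (Suc (p + 1) + 1) (2 ^ (p + 1) + 2 ^ (q + 1) + 2)"
      by (intro realizable_add realizable_two optimal_imp_realizable)
    then show ?thesis by (simp add: numeral_3_eq_3 algebra_simps)
  qed
  show ?thesis
    using assms
  proof cases
    case (three_bits i q p)
    have "realizable (i - 1 + (p + 3)) (2 ^ (i - 1) * (2 * (2 ^ p + 2 ^ q + 1)))"
      using three_bits by (intro realizable_shift three) auto
    moreover have "i - 1 + (p + 3) = k" using three_bits by simp
    moreover have "2 ^ (i - 1) * (2 * (2 ^ p + 2 ^ q + 1)) = v" using three_bits by (cases i) auto
    ultimately show ?thesis by metis
  next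
    case (product i q p)
    have "realizable (i - 2 + (p + 2 + (q + 2))) (2 ^ (i - 2) * (2 * (2 ^ p + 1) * (2 * (2 ^ q + 1))))"
      using product by (intro realizable_shift realizable_mult two) auto
    moreover obtain j where "i = j + 2" using product by (metis le_Suc_ex add.commute)
    ultimately show ?thesis using product by (simp add: power_add algebra_simps)
  next
    case (three_times i r)
    have "realizable (i - 2 + (1 + 2 + (r + 1 + 3)))
        (2 ^ (i - 2) * (2 * (2 ^ 1 + 1) * (2 * (2 ^ (r + 1) + 2 ^ r + 1))))"
      using three_times by (intro realizable_shift realizable_mult two three) auto
    moreover obtain j where "i = j + 2" using three_times by (metis le_Suc_ex add.commute)
    ultimately show ?thesis using three_times by (simp add: power_add algebra_simps)
  next
    case (sporadic i)
    have "realizable (i - 3 + (1 + 2 + (2 + 2 + (3 + 2))))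
        (2 ^ (i - 3) * (2 * (2 ^ 1 + 1) * (2 * (2 ^ 2 + 1) * (2 * (2 ^ 3 + 1)))))"
      by (intro realizable_shift realizable_mult two) auto
    moreover obtain j where "i = j + 3" using sporadic by (metis le_Suc_ex add.commute)
    ultimately show ?thesis using sporadic by (simp add: power_add algebra_simps)
  qed
qed

section \<open>Disjointness of the classes by odd parts\<close>

text \<open>For \<open>optimal (k - 1)\<close> with two bits the odd part is exactly
  \<open>2 ^ t + 1\<close>, with \<open>t\<close> determined by \<open>k\<close> and the power of
  two. Here it is larger: the witnesses for \<open>t\<close> are the leading exponents, as in
  \<open>135 = 2 ^ 7 + 7\<close>.\<close>

lemma suboptimal_odd_part:
  assumes "suboptimal k v"
  obtains j t w where "v = 2 ^ j * w" "odd w" "k = j + t + 2" "2 ^ t + 1 < w"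
  using assms
proof cases
  case (three_bits i q p)
  then show thesis by (intro that[of i "2 ^ p + 2 ^ q + 1" p]) auto
next
  case (product i q p)
  then show thesis
    by (intro that[of i "(2 ^ p + 1) * (2 ^ q + 1)" "p + q"]) (auto simp: power_add algebra_simps)
next
  case (three_times i r)
  then show thesis
    by (intro that[of i "3 * (3 * 2 ^ r + 1)" "r + 3"]) (auto simp: power_add)
next
  case (sporadic i)
  then show thesis by (intro that[of i 135 7]) auto
qed

text \<open>Cancelling the smaller power of two would otherwise equate an odd number with an even
  one.\<close>

lemma power_two_mult_odd_eqD:
  fixes x y :: nat
  assumes "2 ^ i * x = 2 ^ j * y" "odd x" "odd y"
  shows "i = j" "x = y"
proof -
  have False if eq: "2 ^ a * u = 2 ^ b * w" and u: "odd u" and less: "a < b" for a b and u w :: nat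
  proof -
    obtain c where "b = a + Suc c" using less less_iff_Suc_add by auto
    then show False using eq u by (simp add: power_add)
  qed
  from this[OF assms(1,2)] this[OF assms(1)[symmetric] assms(3)] show "i = j"
    by (meson linorder_neqE_nat)
  then show "x = y" using assms(1) by simp
qed

text \<open>Powers are excluded by size. For two bits, equal powers of two give
  \<open>s = t\<close>, contradicting the strict bound on the odd part.\<close>

lemma suboptimal_imp_not_optimal:
  assumes "suboptimal (Suc k) v"
  shows "\<not> optimal k v"
proof
  assume "optimal k v"
  then show False
  proof cases
    case power
    then show False using suboptimal_less[OF assms] by simp
  next
    case (two_bits i s)
    obtain j t w where w: "v = 2 ^ j * w" "odd w" "Suc k = j + t + 2" "2 ^ t + 1 < w"
      using suboptimal_odd_part[OF assms] .
    have "2 ^ i * (2 ^ s + 1) = 2 ^ j * w" "odd (2 ^ s + (1::nat))" using two_bits w by auto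
    then have "i = j" "2 ^ s + 1 = w" using power_two_mult_odd_eqD w(2) by blast+
    then show False using two_bits w by simp
  qed
qed

section \<open>Binary expansions and the complexity\<close>

lemma optimal_iff:
  "optimal (m + 1) n \<longleftrightarrow> n = 2 ^ (m + 1) \<or> (\<exists>m'. 1 \<le> m' \<and> m' < m \<and> n = 2 ^ m + 2 ^ m')"
    (is "_ \<longleftrightarrow> ?R")
proof
  assume "optimal (m + 1) n"
  then show ?R
  proof cases
    case (two_bits i s)
    then have "1 \<le> i \<and> i < m \<and> n = 2 ^ m + 2 ^ i" by (auto simp: power_add algebra_simps)
    then show ?thesis by blast
  qed simp
next
  assume ?R
  then show "optimal (m + 1) n"
    using optimal_power_add[of _ m] by (auto intro: optimal.power)
qed

text \<open>Expanding the odd parts in binary gives the four forms: \<open>three_times\<close>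
  becomes \<open>2 ^ (r + 3) + 2 ^ r + 2 + 1\<close> and 135 becomes
  \<open>2 ^ 7 + 2 ^ 2 + 2 + 1\<close>. The lower bounds on the lowest exponent are those on
  \<open>i\<close>.\<close>

lemma suboptimal_iff:
  "suboptimal (m + 2) n \<longleftrightarrow>
      (\<exists>m1 m2 m3. m = m1 \<and> m1 > m2 \<and> m2 > m3 \<and> m3 \<ge> 1 \<and>
         n = 2 ^ m1 + 2 ^ m2 + 2 ^ m3) \<or>
      (\<exists>m1 m2 m3 m4. m = m1 \<and> m1 > m2 \<and> m2 > m3 \<and> m3 > m4 \<and> m4 \<ge> 2 \<and>
         m1 + m4 = m2 + m3 \<and> n = 2 ^ m1 + 2 ^ m2 + 2 ^ m3 + 2 ^ m4) \<or>
      (\<exists>m1 m2. m = m1 \<and> m1 \<ge> m2 + 3 \<and> m2 + 3 \<ge> 6 \<and>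
         n = 2 ^ m1 + 2 ^ (m1 - 3) + 2 ^ m2 + 2 ^ (m2 - 1)) \<or>
      (m \<ge> 10 \<and> n = 2 ^ m + 2 ^ (m - 5) + 2 ^ (m - 6) + 2 ^ (m - 7))"
    (is "_ \<longleftrightarrow> ?a \<or> ?b \<or> ?c \<or> ?d")
proof
  assume "suboptimal (m + 2) n"
  then show "?a \<or> ?b \<or> ?c \<or> ?d"
  proof cases
    case (three_bits i q p)
    then have ?a
      by (intro exI[of _ m] exI[of _ "i + q"] exI[of _ i]) (auto simp: power_add algebra_simps)
    then show ?thesis by blast
  next
    case (product i q p)
    then have ?b
      by (intro exI[of _ m] exI[of _ "i + p"] exI[of _ "i + q"] exI[of _ i])
        (auto simp: power_add algebra_simps)
    then show ?thesis by blast
  next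
    case (three_times i r)
    then have m: "m = i + r + 3" by simp
    then have ?c
      using three_times by (intro exI[of _ m] exI[of _ "i + 1"]) (auto simp: power_add algebra_simps)
    then show ?thesis by blast
  next
    case (sporadic i)
    then have m: "m = i + 7" by simp
    then have ?d using sporadic by (auto simp: power_add)
    then show ?thesis by blast
  qed
next
  assume "?a \<or> ?b \<or> ?c \<or> ?d"
  then consider ?a | ?b | ?c | ?d by blast
  then show "suboptimal (m + 2) n"
  proof cases
    case 1
    then obtain m2 i where a: "m2 < m" "i < m2" "1 \<le> i" "n = 2 ^ m + 2 ^ m2 + 2 ^ i" by blast
    then obtain q p where "m2 = i + q" "m = i + p" by (metis less_imp_le less_trans le_Suc_ex)
    then show ?thesis
      using a by (intro suboptimal.three_bits[of i q p]) (auto simp: power_add algebra_simps)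
  next
    case 2
    then obtain m2 m3 i where b: "m2 < m" "m3 < m2" "i < m3" "2 \<le> i" "m + i = m2 + m3"
      "n = 2 ^ m + 2 ^ m2 + 2 ^ m3 + 2 ^ i" by blast
    then obtain p q where pq: "m2 = i + p" "m3 = i + q" by (metis less_imp_le less_trans le_Suc_ex)
    then have "m = i + p + q" using b by simp
    then show ?thesis
      using b pq by (intro suboptimal.product[of i q p]) (auto simp: power_add algebra_simps)
  next
    case 3
    then obtain m2 where c: "m2 + 3 \<le> m" "3 \<le> m2"
      "n = 2 ^ m + 2 ^ (m - 3) + 2 ^ m2 + 2 ^ (m2 - 1)" by auto
    obtain i where i: "m2 = i + 1" using c by (cases m2) auto
    obtain t where "m = m2 + 3 + t" using c le_Suc_ex by blast
    then show ?thesis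
      using c i by (intro suboptimal.three_times[of i "t + 1"]) (auto simp: power_add algebra_simps)
  next
    case 4
    then obtain t where "m = 10 + t" using le_Suc_ex by blast
    then show ?thesis
      using 4 by (intro suboptimal.sporadic[of "t + 3"]) (auto simp: power_add algebra_simps)
  qed
qed

lemma l_complexity_two_eq_iff:
  assumes "even n" "n > 0" "2 ^ m < n"
  shows "l_complexity 2 n = m + 1 \<longleftrightarrow> optimal (m + 1) n"
    and "n \<le> 2 ^ (m + 1) \<Longrightarrow> l_complexity 2 n = m + 2 \<longleftrightarrow> suboptimal (m + 2) n"
proof -
  obtain e where e: "l_value 2 e = n" "copies e = l_complexity 2 n"
    using l_complexity_witness assms by blast
  have le: "l_complexity 2 n \<le> k" if "realizable k n" for k
    using that l_complexity_le unfolding realizable_def by metis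
  \<comment> \<open>Fewer than \<open>m + 1\<close> copies cannot exceed
    \<open>2 ^ m\<close>.\<close>
  have "(2::nat) ^ m < 2 ^ l_complexity 2 n"
    using l_value_le[of e] e assms(3) by (metis order_less_le_trans)
  then have lower: "m + 1 \<le> l_complexity 2 n" by simp
  show opt: "l_complexity 2 n = m + 1 \<longleftrightarrow> optimal (m + 1) n"
  proof
    assume "l_complexity 2 n = m + 1"
    then show "optimal (m + 1) n"
      \<comment> \<open>With \<open>m + 1\<close> copies, \<open>n\<close> exceeds half of
        \<open>2 ^ (m + 1)\<close>; with \<open>m + 2\<close> copies below, it only exceeds a
        quarter of \<open>2 ^ (m + 2)\<close>.\<close>
      using nearly_optimal_imp_optimal[of "m + 1" n] l_value_nearly_optimal[of e] e assms by simp
  next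
    assume "optimal (m + 1) n"
    then show "l_complexity 2 n = m + 1"
      using le optimal_imp_realizable lower by fastforce
  qed
  show "l_complexity 2 n = m + 2 \<longleftrightarrow> suboptimal (m + 2) n" if "n \<le> 2 ^ (m + 1)"
  proof
    assume *: "l_complexity 2 n = m + 2"
    then have "nearly_optimal (m + 2) n"
      using l_value_nearly_optimal[of e] e assms by simp
    moreover have "\<not> optimal (m + 1) n" using opt * by simp
    \<comment> \<open>An \<open>optimal (m + 2)\<close> value would exceed
      \<open>2 ^ (m + 1)\<close>, so the upper bound on \<open>n\<close> rules it out.\<close>
    moreover have "\<not> optimal (m + 2) n"
      using optimal_less[of "m + 2" n] that by auto
    ultimately show "suboptimal (m + 2) n" by (simp add: nearly_optimal_def)
  next
    assume *: "suboptimal (m + 2) n"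
    then have "\<not> optimal (m + 1) n"
      using suboptimal_imp_not_optimal[of "m + 1" n] by simp
    then show "l_complexity 2 n = m + 2"
      using le[OF suboptimal_imp_realizable[OF *]] lower opt by simp
  qed
qed

theorem theorem1p2:
  fixes n m :: nat
  assumes "even n" and "n > 0"
    and "int m = \<lceil>log 2 (real n)\<rceil> - 1"
  shows "2 ^ m < n \<and> n \<le> 2 ^ (m + 1) \<and>
    (l_complexity 2 n = m + 1 \<longleftrightarrow>
      n = 2 ^ (m + 1) \<or> (\<exists>m'. 1 \<le> m' \<and> m' < m \<and> n = 2 ^ m + 2 ^ m')) \<and>
    (l_complexity 2 n = m + 2 \<longleftrightarrow>
      (\<exists>m1 m2 m3. m = m1 \<and> m1 > m2 \<and> m2 > m3 \<and> m3 \<ge> 1 \<and>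
         n = 2 ^ m1 + 2 ^ m2 + 2 ^ m3) \<or>
      (\<exists>m1 m2 m3 m4. m = m1 \<and> m1 > m2 \<and> m2 > m3 \<and> m3 > m4 \<and> m4 \<ge> 2 \<and>
         m1 + m4 = m2 + m3 \<and> n = 2 ^ m1 + 2 ^ m2 + 2 ^ m3 + 2 ^ m4) \<or>
      (\<exists>m1 m2. m = m1 \<and> m1 \<ge> m2 + 3 \<and> m2 + 3 \<ge> 6 \<and>
         n = 2 ^ m1 + 2 ^ (m1 - 3) + 2 ^ m2 + 2 ^ (m2 - 1)) \<or>
      (m \<ge> 10 \<and> n = 2 ^ m + 2 ^ (m - 5) + 2 ^ (m - 6) + 2 ^ (m - 7)))"
proof -
  have "\<lceil>log (real 2) (real n)\<rceil> = int m + 1" using assms(3) by simp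
  then have n: "2 ^ m < n" "n \<le> 2 ^ (m + 1)"
    using ceiling_log_nat_eq_powr_iff[of 2 n m] assms(2) by auto
  show ?thesis
    using n l_complexity_two_eq_iff[OF assms(1,2) n(1)]
    unfolding optimal_iff[symmetric] suboptimal_iff[symmetric] by simp
qed

end
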